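(* Let $n>1$ and $1\le k\le n$ be integers, and let $G_1,\ldots,G_s$ be representatives of the isomorphism classes of the components of $G(n,k)$, where the unique cycle in $G_i$ has length $r_i$. Then for each $1\le i\le s$, $\mathrm{Aut}(G_i)\cong \mathrm{Aut}(T_1)\wr\langle\sigma_i\rangle$, where $\sigma_i$ is the $r_i$-cycle $\sigma_i=\begin{pmatrix}1&2&3&\cdots&r_i\\2&3&4&\cdots&1\end{pmatrix}$, regarded as a permutation of $\{1,\ldots,r_i\}$.
   Context: Let $H$ be a cyclic group (written multiplicatively, identity $1$) with $n>1$ elements, let $1\le k\le n$, and let $f:H\to H$, $f(x)=x^k$. $G(n,k)$ is the digraph with vertex set $H$ and a directed edge from $a$ to $b$ if and only if $f(a)=b$ (loops allowed). Components are the (weakly) connected components; each contains exactly one directed cycle (a loop is a cycle of length $1$). $T_1$ is the tree attached to the identity element $1$: its vertex set is $\{a\in H: a^{k^m}=1 \text{ for some } m\ge 0\}$, and it is the induced subgraph of $G(n,k)$ on this set with the loop at $1$ deleted. $\mathrm{Aut}(G)$ denotes the automorphism group of a digraph $G$, viewed as a permutation group on its vertices. For permutation groups $P_1$ on $\{1,\ldots,m\}$ and $P_2$ on $\{1,\ldots,r\}$, the wreath product $P_1\wr P_2$ is the group generated by the direct product of $r$ copies of $P_1$ together with the elements of $P_2$ acting on (permuting) these $r$ copies of $P_1$. *)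

theory Defs
  imports
    "HOL-Algebra.Elementary_Groups"
    "HOL-Algebra.Sym_Groups"
    "Graph_Theory.Graph_Theory"
begin

section \<open>Power digraphs\<close>

definition power_digraph :: "('a, 'm) monoid_scheme \<Rightarrow> nat \<Rightarrow> ('a, 'a \<times> 'a) pre_digraph" where
  "power_digraph H k =
     \<lparr> verts = carrier H, arcs = {(a, a [^]\<^bsub>H\<^esub> k) | a. a \<in> carrier H}, tail = fst, head = snd \<rparr>"

text \<open>
  Digraph connectedness in the graph library is connectedness of the underlying symmetric
  graph, so these are the weakly connected components.
\<close>
definition components :: "('a, 'b) pre_digraph \<Rightarrow> ('a, 'b) pre_digraph set" where
  "components D = {C. pre_digraph.max_subgraph D Digraph_Component.connected C}"

text \<open>
  Cycles are non-empty closed arc lists, so a loop is a cycle of length 1. The value is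
  meaningful only if all cycles of the digraph have the same length, as is the case when the
  cycle is unique up to the choice of its starting vertex.
\<close>
definition cycle_length :: "('a, 'b) pre_digraph \<Rightarrow> nat" where
  "cycle_length D = (THE l. \<exists>p. pre_digraph.cycle D p \<and> length p = l)"

definition identity_tree :: "('a, 'm) monoid_scheme \<Rightarrow> nat \<Rightarrow> ('a, 'a \<times> 'a) pre_digraph" where
  "identity_tree H k =
     pre_digraph.del_arc
       (power_digraph H k \<restriction> {a \<in> carrier H. \<exists>m. a [^]\<^bsub>H\<^esub> (k ^ m) = \<one>\<^bsub>H\<^esub>})
       (\<one>\<^bsub>H\<^esub>, \<one>\<^bsub>H\<^esub>)"


section \<open>Automorphism groups and wreath products\<close>

text \<open>
  As in \<^const>\<open>sym_group\<close>, permutations of a set are total functions fixing everything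
  outside of it.
\<close>
definition sym_group_on :: "'a set \<Rightarrow> ('a \<Rightarrow> 'a) monoid" where
  "sym_group_on S = \<lparr> carrier = {p. p permutes S}, monoid.mult = (\<circ>), one = id \<rparr>"

text \<open>
  Automorphisms are recorded by their action on the vertices only; this loses nothing for
  digraphs without parallel arcs.
\<close>
definition digraph_aut :: "('a, 'b) pre_digraph \<Rightarrow> ('a \<Rightarrow> 'a) monoid" where
  "digraph_aut D =
     (sym_group_on (verts D))
       \<lparr> carrier := {p. p permutes verts D \<and>
           (\<forall>u\<in>verts D. \<forall>v\<in>verts D. (p u, p v) \<in> arcs_ends D \<longleftrightarrow> (u, v) \<in> arcs_ends D)} \<rparr>"

text \<open>
  The wreath product of a permutation group \<open>P\<close> on \<open>\<Omega>\<close> and a permutation group \<open>Q\<close> on \<open>\<Delta>\<close>,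
  as a permutation group on \<open>\<Omega> \<times> \<Delta>\<close>. The block \<open>\<Omega> \<times> {j}\<close> carries the copy of \<open>P\<close> with index
  \<open>j\<close>: \<open>wreath_base\<close> is the direct product of these copies, and \<open>wreath_top\<close> is \<open>Q\<close> permuting
  the blocks and hence, by conjugation, the copies.
\<close>
definition wreath_base :: "('a \<Rightarrow> 'a) monoid \<Rightarrow> 'b set \<Rightarrow> ('a \<times> 'b \<Rightarrow> 'a \<times> 'b) set" where
  "wreath_base P \<Delta> =
     {\<lambda>(x, j). (if j \<in> \<Delta> then g j x else x, j) | g. \<forall>j\<in>\<Delta>. g j \<in> carrier P}"

definition wreath_top :: "'a set \<Rightarrow> ('b \<Rightarrow> 'b) monoid \<Rightarrow> ('a \<times> 'b \<Rightarrow> 'a \<times> 'b) set" where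
  "wreath_top \<Omega> Q = {\<lambda>(x, j). (x, if x \<in> \<Omega> then q j else j) | q. q \<in> carrier Q}"

definition wreath_product ::
    "'a set \<Rightarrow> ('a \<Rightarrow> 'a) monoid \<Rightarrow> 'b set \<Rightarrow> ('b \<Rightarrow> 'b) monoid \<Rightarrow> ('a \<times> 'b \<Rightarrow> 'a \<times> 'b) monoid" where
  "wreath_product \<Omega> P \<Delta> Q =
     subgroup_generated (sym_group_on (\<Omega> \<times> \<Delta>)) (wreath_base P \<Delta> \<union> wreath_top \<Omega> Q)"

lemma group_sym_group_on: "group (sym_group_on S)"
proof (rule groupI)
  fix p assume "p \<in> carrier (sym_group_on S)"
  then show "\<exists>q\<in>carrier (sym_group_on S). q \<otimes>\<^bsub>sym_group_on S\<^esub> p = \<one>\<^bsub>sym_group_on S\<^esub>"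
    by (auto simp: sym_group_on_def intro!: bexI[of _ "inv_into UNIV p"] permutes_inv permutes_inv_o)
qed (auto simp: sym_group_on_def permutes_compose permutes_id comp_assoc)

lemma group_digraph_aut: "group (digraph_aut D)"
proof -
  let ?S = "sym_group_on (verts D)"
  let ?A = "{p. p permutes verts D \<and>
     (\<forall>u\<in>verts D. \<forall>v\<in>verts D. (p u, p v) \<in> arcs_ends D \<longleftrightarrow> (u, v) \<in> arcs_ends D)}"
  interpret S: group ?S by (rule group_sym_group_on)
  have "inv\<^bsub>?S\<^esub> p \<in> ?A" if p: "p \<in> ?A" for p
  proof -
    let ?q = "inv_into UNIV p"
    have perm: "p permutes verts D" "?q permutes verts D"
      using p by (simp_all add: permutes_inv)
    have i: "inv\<^bsub>?S\<^esub> p = ?q"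
      using perm by (intro S.inv_equality) (simp_all add: sym_group_on_def permutes_inv_o)
    have "(?q u, ?q v) \<in> arcs_ends D \<longleftrightarrow> (u, v) \<in> arcs_ends D"
      if "u \<in> verts D" "v \<in> verts D" for u v
    proof -
      have "?q u \<in> verts D" "?q v \<in> verts D"
        using that by (simp_all add: permutes_in_image[OF perm(2)])
      then have "(p (?q u), p (?q v)) \<in> arcs_ends D \<longleftrightarrow> (?q u, ?q v) \<in> arcs_ends D"
        using p by blast
      then show ?thesis by (simp add: permutes_inverses(1)[OF perm(1)])
    qed
    then show ?thesis unfolding i using perm(2) by blast
  qed
  moreover have "p \<otimes>\<^bsub>?S\<^esub> q \<in> ?A" if "p \<in> ?A" "q \<in> ?A" for p q
    using that by (simp add: sym_group_on_def permutes_compose permutes_in_image)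
  moreover have "id \<in> ?A" by (simp add: permutes_id)
  then have "?A \<noteq> {}" by blast
  moreover have "?A \<subseteq> carrier ?S" by (auto simp: sym_group_on_def)
  ultimately have "subgroup ?A ?S" by (intro S.subgroupI)
  then show ?thesis
    unfolding digraph_aut_def by (rule S.subgroup_imp_group)
qed

lemma group_wreath_product: "group (wreath_product \<Omega> P \<Delta> Q)"
  unfolding wreath_product_def by (rule group.group_subgroup_generated[OF group_sym_group_on])

text \<open>
  Generators outside of the ambient group are ignored by \<^const>\<open>subgroup_generated\<close>; for
  permutation groups \<open>P\<close> and \<open>Q\<close> there are none.
\<close>
lemma wreath_base_subset:
  assumes "carrier P \<subseteq> {p. p permutes \<Omega>}"
  shows "wreath_base P \<Delta> \<subseteq> carrier (sym_group_on (\<Omega> \<times> \<Delta>))"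
proof
  fix f assume "f \<in> wreath_base P \<Delta>"
  then obtain g where f: "f = (\<lambda>(x, j). (if j \<in> \<Delta> then g j x else x, j))"
    and g: "\<And>j. j \<in> \<Delta> \<Longrightarrow> g j permutes \<Omega>"
    using assms by (force simp: wreath_base_def)
  have "bij f"
    by (rule o_bij[of "\<lambda>(x, j). (if j \<in> \<Delta> then inv_into UNIV (g j) x else x, j)"])
      (auto simp: f fun_eq_iff permutes_inverses[OF g])
  moreover have "f z = z" if "z \<notin> \<Omega> \<times> \<Delta>" for z
    using that permutes_not_in[OF g] by (cases z) (simp add: f, blast)
  ultimately show "f \<in> carrier (sym_group_on (\<Omega> \<times> \<Delta>))"
    by (simp add: sym_group_on_def permutes_conv_has_dom has_dom_def)
qed

lemma wreath_top_subset:
  assumes "carrier Q \<subseteq> {q. q permutes \<Delta>}"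
  shows "wreath_top \<Omega> Q \<subseteq> carrier (sym_group_on (\<Omega> \<times> \<Delta>))"
proof
  fix f assume "f \<in> wreath_top \<Omega> Q"
  then obtain q where f: "f = (\<lambda>(x, j). (x, if x \<in> \<Omega> then q j else j))" and q: "q permutes \<Delta>"
    using assms by (force simp: wreath_top_def)
  have "bij f"
    by (rule o_bij[of "\<lambda>(x, j). (x, if x \<in> \<Omega> then inv_into UNIV q j else j)"])
      (auto simp: f fun_eq_iff permutes_inverses[OF q])
  moreover have "f z = z" if "z \<notin> \<Omega> \<times> \<Delta>" for z
    using that permutes_not_in[OF q] by (cases z) (auto simp: f)
  ultimately show "f \<in> carrier (sym_group_on (\<Omega> \<times> \<Delta>))"
    by (simp add: sym_group_on_def permutes_conv_has_dom has_dom_def)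
qed

end

theory Submission
  imports Defs
begin

text \<open>
  Write \<open>f\<close> for the power map, \<open>T\<close> for the vertices of the identity tree (the elements killed
  by some power of \<open>f\<close>), and let \<open>c\<close> be a point of period \<open>r\<close> on the cycle of a component \<open>C\<close>.

  The power map is an endomorphism of a commutative group. Because of this, multiplication by
  suitable periodic elements carries the identity tree to the tree hanging at any other periodic
  element, so that \<open>C\<close> consists of \<open>r\<close> copies of the identity tree whose roots are joined in a
  cycle. Explicitly, if \<open>t \<in> T\<close> reaches \<open>1\<close> after exactly \<open>h\<close> steps, then the vertex
  at position \<open>t\<close> in the tree hanging at \<open>f\<^sup>j c\<close> is \<open>t \<cdot> p\<close>, where \<open>p\<close> is the point on the cycle
  lying \<open>h\<close> steps before \<open>f\<^sup>j c\<close>. This is the bijection \<open>T \<times> {1..r} \<rightarrow> C\<close> of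
  \<open>bij_betw_attach\<close>, and by \<open>attach_hang_on\<close> it carries the map that moves along \<open>f\<close> inside a copy
  of the tree, and from root to root along the cycle, to \<open>f\<close>.

  It remains to determine the permutations of \<open>T \<times> {1..r}\<close> that commute with this model map. Such
  a permutation preserves the set of periodic points, that is, of roots, and so permutes the roots
  by a permutation commuting with the \<open>r\<close>-cycle, which is a power of it. A vertex follows the root
  it flows into, so the copies of the tree are permuted as blocks, and each copy is mapped to
  its image by a root-preserving automorphism of the tree. Hence these permutations are exactly the elements
  of the wreath product (\<open>wreath_product_eq_commuting_perms\<close>): in the model the two groups are
  equal as permutation groups.

  Digraph automorphisms enter through the observation that in a digraph where every vertex has
  exactly one outgoing arc they are the permutations commuting with the successor map. The identity
  tree is a slight exception, as its root has lost its arc; there they have to fix the root as well.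
\<close>

section \<open>Functional digraphs\<close>

definition functional_digraph :: "'a set \<Rightarrow> ('a \<Rightarrow> 'a) \<Rightarrow> ('a, 'a \<times> 'a) pre_digraph" where
  "functional_digraph V f = \<lparr> verts = V, arcs = {(a, f a) | a. a \<in> V}, tail = fst, head = snd \<rparr>"

definition commuting_perms :: "'a set \<Rightarrow> ('a \<Rightarrow> 'a) \<Rightarrow> ('a \<Rightarrow> 'a) set" where
  "commuting_perms V f = {p. p permutes V \<and> (\<forall>x\<in>V. p (f x) = f (p x))}"

lemma power_digraph_functional: "power_digraph H k = functional_digraph (carrier H) (\<lambda>a. a [^]\<^bsub>H\<^esub> k)"
  by (simp add: power_digraph_def functional_digraph_def)

lemma wf_functional_digraph:
  assumes "f \<in> V \<rightarrow> V"
  shows "wf_digraph (functional_digraph V f)"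
  using assms by unfold_locales (auto simp: functional_digraph_def)

lemma arcs_ends_functional_digraph: "arcs_ends (functional_digraph V f) = {(a, f a) | a. a \<in> V}"
  by (force simp: functional_digraph_def arcs_ends_def arc_to_ends_def)

lemma digraph_aut_functional_digraph:
  assumes f: "f \<in> V \<rightarrow> V"
  shows "digraph_aut (functional_digraph V f)
    = (sym_group_on V) \<lparr> carrier := commuting_perms V f \<rparr>"
proof -
  have "(\<forall>u\<in>V. \<forall>v\<in>V. (p u, p v) \<in> {(a, f a) | a. a \<in> V} \<longleftrightarrow> (u, v) \<in> {(a, f a) | a. a \<in> V})
    \<longleftrightarrow> (\<forall>x\<in>V. p (f x) = f (p x))" (is "?L \<longleftrightarrow> ?R") if p: "p permutes V" for p
  proof
    assume L: ?L
    show ?R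
    proof
      fix x assume x: "x \<in> V"
      then have "f x \<in> V" using f by auto
      with L x have "(p x, p (f x)) \<in> {(a, f a) | a. a \<in> V}" by blast
      then show "p (f x) = f (p x)" by auto
    qed
  next
    assume R: ?R
    have "p u \<in> V" if "u \<in> V" for u using that permutes_in_image[OF p] by simp
    moreover have "v = w" if "p v = p w" for v w using that permutes_inj[OF p] by (auto dest: injD)
    ultimately show ?L using R by (smt (verit, best) Pair_inject mem_Collect_eq)
  qed
  then show ?thesis
    unfolding digraph_aut_def arcs_ends_functional_digraph commuting_perms_def
    by (simp add: functional_digraph_def cong: conj_cong)
qed

lemma commuting_perms_funpow:
  assumes "p \<in> commuting_perms V f" "f \<in> V \<rightarrow> V" "x \<in> V"
  shows "p ((f ^^ m) x) = (f ^^ m) (p x)"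
proof -
  have "(f ^^ m) x \<in> V" for m using assms by (induction m) auto
  then show ?thesis using assms by (induction m) (auto simp: commuting_perms_def)
qed

lemma subgroup_commuting_perms:
  assumes f: "f \<in> V \<rightarrow> V"
  shows "subgroup (commuting_perms V f) (sym_group_on V)"
proof -
  interpret S: group "sym_group_on V" by (rule group_sym_group_on)
  show ?thesis
  proof (rule S.subgroupI)
    show "commuting_perms V f \<subseteq> carrier (sym_group_on V)"
      by (auto simp: commuting_perms_def sym_group_on_def)
    have "id \<in> commuting_perms V f" by (simp add: commuting_perms_def permutes_id)
    then show "commuting_perms V f \<noteq> {}" by blast
  next
    fix p assume p: "p \<in> commuting_perms V f"
    then have perm: "p permutes V" by (simp add: commuting_perms_def)
    let ?q = "inv_into UNIV p"
    have q: "?q permutes V" using perm by (rule permutes_inv)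
    have i: "inv\<^bsub>sym_group_on V\<^esub> p = ?q"
      using perm q by (intro S.inv_equality) (simp_all add: sym_group_on_def permutes_inv_o)
    have "?q (f x) = f (?q x)" if x: "x \<in> V" for x
    proof -
      have "?q x \<in> V" using x by (simp add: permutes_in_image[OF q])
      then have "p (f (?q x)) = f x"
        using p permutes_inverses(1)[OF perm] by (simp add: commuting_perms_def)
      then show ?thesis by (metis permutes_inverses(2)[OF perm])
    qed
    then show "inv\<^bsub>sym_group_on V\<^esub> p \<in> commuting_perms V f"
      using q unfolding i by (simp add: commuting_perms_def)
  next
    fix p q assume "p \<in> commuting_perms V f" "q \<in> commuting_perms V f"
    then show "p \<otimes>\<^bsub>sym_group_on V\<^esub> q \<in> commuting_perms V f"
      by (auto simp: commuting_perms_def sym_group_on_def permutes_compose permutes_in_image)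
  qed
qed

text \<open>
  The isomorphism is conjugation by \<open>\<Psi>\<close>, extended by the identity outside of \<open>B\<close>.
\<close>
lemma commuting_perms_iso:
  assumes \<Psi>: "bij_betw \<Psi> A B" and F: "F \<in> A \<rightarrow> A"
    and equiv: "\<And>x. x \<in> A \<Longrightarrow> \<Psi> (F x) = f (\<Psi> x)"
  shows "(sym_group_on A) \<lparr> carrier := commuting_perms A F \<rparr>
    \<cong> (sym_group_on B) \<lparr> carrier := commuting_perms B f \<rparr>"
proof -
  let ?i = "inv_into A \<Psi>"
  define \<Phi> where "\<Phi> p = (\<lambda>y. if y \<in> B then \<Psi> (p (?i y)) else y)" for p
  define \<Phi>' where "\<Phi>' q = (\<lambda>x. if x \<in> A then ?i (q (\<Psi> x)) else x)" for q
  have i: "bij_betw ?i B A" using \<Psi> by (rule bij_betw_inv_into)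
  have \<Psi>i: "\<Psi> (?i y) = y" if "y \<in> B" for y
    using that \<Psi> by (simp add: bij_betw_inv_into_right)
  have i\<Psi>: "?i (\<Psi> x) = x" if "x \<in> A" for x
    using that \<Psi> by (simp add: bij_betw_inv_into_left)
  have iB: "?i y \<in> A" if "y \<in> B" for y using that i by (rule bij_betw_apply[rotated])
  have \<Psi>A: "\<Psi> x \<in> B" if "x \<in> A" for x using that \<Psi> by (rule bij_betw_apply[rotated])
  have FA: "F x \<in> A" if "x \<in> A" for x using that F by auto
  have fB: "f y \<in> B" "?i (f y) = F (?i y)" if "y \<in> B" for y
  proof -
    have "f y = \<Psi> (F (?i y))" using that by (simp add: equiv iB \<Psi>i)
    then show "f y \<in> B" "?i (f y) = F (?i y)" using that by (simp_all add: \<Psi>A FA iB i\<Psi>)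
  qed
  have \<Phi>: "\<Phi> p \<in> commuting_perms B f" if p: "p \<in> commuting_perms A F" for p
  proof -
    have perm: "p permutes A" using p by (simp add: commuting_perms_def)
    have "\<Phi> p permutes B" unfolding \<Phi>_def using perm \<Psi> by (rule permutes_bij_inv_into)
    moreover have "\<Phi> p (f y) = f (\<Phi> p y)" if y: "y \<in> B" for y
      using p y by (simp add: \<Phi>_def fB commuting_perms_def iB equiv permutes_in_image[OF perm])
    ultimately show ?thesis by (simp add: commuting_perms_def)
  qed
  have \<Phi>': "\<Phi>' q \<in> commuting_perms A F" if q: "q \<in> commuting_perms B f" for q
  proof -
    have perm: "q permutes B" using q by (simp add: commuting_perms_def)
    have "(\<lambda>x. if x \<in> A then ?i (q (inv_into B ?i x)) else x) permutes A"
      using perm i by (rule permutes_bij_inv_into)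
    then have "\<Phi>' q permutes A"
      unfolding \<Phi>'_def using \<Psi> by (simp add: inv_into_inv_into_eq cong: if_cong)
    moreover have "\<Phi>' q (F x) = F (\<Phi>' q x)" if x: "x \<in> A" for x
      using q x by (simp add: \<Phi>'_def FA equiv commuting_perms_def \<Psi>A fB permutes_in_image[OF perm])
    ultimately show ?thesis by (simp add: commuting_perms_def)
  qed
  have "bij_betw \<Phi> (commuting_perms A F) (commuting_perms B f)"
  proof (rule bij_betw_byWitness[where f' = \<Phi>'])
    show "\<forall>p\<in>commuting_perms A F. \<Phi>' (\<Phi> p) = p"
      by (auto simp: \<Phi>_def \<Phi>'_def commuting_perms_def \<Psi>A i\<Psi> fun_eq_iff permutes_not_in permutes_in_image)
    show "\<forall>q\<in>commuting_perms B f. \<Phi> (\<Phi>' q) = q"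
      by (auto simp: \<Phi>_def \<Phi>'_def commuting_perms_def iB \<Psi>i fun_eq_iff permutes_not_in permutes_in_image)
  qed (use \<Phi> \<Phi>' in auto)
  moreover have "\<Phi> (p \<circ> q) = \<Phi> p \<circ> \<Phi> q" if "q \<in> commuting_perms A F" for p q
    using that by (auto simp: \<Phi>_def commuting_perms_def fun_eq_iff \<Psi>A i\<Psi> iB permutes_in_image)
  ultimately show ?thesis
    using \<Phi> by (intro is_isoI[of \<Phi>] isoI homI) (auto simp: sym_group_on_def)
qed


section \<open>Components and cycles of functional digraphs\<close>

text \<open>
  A maximal connected subgraph contains every arc that touches it: otherwise adding that arc would
  give a larger connected subgraph.
\<close>
lemma max_connected_subgraph_arc:
  assumes max: "pre_digraph.max_subgraph D Digraph_Component.connected C"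
    and e: "e \<in> arcs D" and w: "w \<in> {tail D e, head D e}" "w \<in> verts C"
  shows "e \<in> arcs C"
proof -
  let ?C = "pre_digraph.add_arc C e"
  have sub: "subgraph C D" and conn: "Digraph_Component.connected C"
    using max by (auto simp: pre_digraph.max_subgraph_def)
  have comp: "tail C = tail D" "head C = head D"
    using sub by (auto simp: subgraph_def compatible_def)
  interpret D: wf_digraph D using sub by (simp add: subgraph_def)
  interpret C: wf_digraph C using sub by (simp add: subgraph_def)
  have vC: "verts ?C = verts C \<union> {tail D e, head D e}" and aC: "arcs ?C = insert e (arcs C)"
    and thC: "tail ?C = tail D" "head ?C = head D"
    by (simp_all add: C.add_arc_def comp)
  have wfC: "wf_digraph ?C"
    using C.tail_in_verts C.head_in_verts by unfold_locales (auto simp: vC aC thC comp)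
  have subC: "subgraph C ?C" "subgraph ?C D"
    using sub e wfC by (auto simp: subgraph_def compatible_def vC aC thC comp)
  let ?E = "(arcs_ends ?C)\<^sup>s"
  have to_w: "(u, w) \<in> rtrancl_on (verts ?C) ?E \<and> (w, u) \<in> rtrancl_on (verts ?C) ?E"
    if u: "u \<in> verts ?C" for u
  proof (cases "u \<in> verts C")
    case True
    have "(arcs_ends C)\<^sup>s \<subseteq> ?E"
      using arcs_ends_mono[OF subC(1)] by (auto simp: symcl_def)
    moreover have "verts C \<subseteq> verts ?C" by (auto simp: vC)
    moreover have "(u, w) \<in> rtrancl_on (verts C) ((arcs_ends C)\<^sup>s)"
        "(w, u) \<in> rtrancl_on (verts C) ((arcs_ends C)\<^sup>s)"
      using conn True w(2) by (simp_all add: connected_conv)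
    ultimately show ?thesis by (meson rtrancl_on_mono)
  next
    case False
    have "(tail D e, head D e) \<in> arcs_ends ?C"
      by (auto simp: arcs_ends_def arc_to_ends_def aC thC comp)
    then have "(u, w) \<in> ?E" "(w, u) \<in> ?E"
      using False u w by (auto simp: vC symcl_def)
    moreover have "w \<in> verts ?C" using w(2) by (simp add: vC)
    ultimately show ?thesis
      using u by (meson rtrancl_on_refl rtrancl_on_into_rtrancl_on)
  qed
  have "Digraph_Component.connected ?C"
    unfolding connected_conv
  proof (intro conjI ballI)
    show "verts ?C \<noteq> {}" by (simp add: vC)
    fix u v assume "u \<in> verts ?C" "v \<in> verts ?C"
    then show "(u, v) \<in> rtrancl_on (verts ?C) ?E"
      using to_w by (blast intro: rtrancl_on_trans)
  qed
  then have "?C = C"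
    using max subC by (auto simp: pre_digraph.max_subgraph_def)
  then show ?thesis using aC by auto
qed

text \<open>
  The last conclusion is the form in which connectedness is used: orbits of any two vertices of a
  component merge. This relation survives a step along an arc in either direction.
\<close>
lemma component_functional_digraph:
  assumes C: "C \<in> components (functional_digraph V f)"
  shows "C = functional_digraph (verts C) f" and "verts C \<noteq> {}" and "verts C \<subseteq> V"
    and "\<And>a. a \<in> V \<Longrightarrow> f a \<in> verts C \<longleftrightarrow> a \<in> verts C"
    and "\<And>a b. a \<in> verts C \<Longrightarrow> b \<in> verts C \<Longrightarrow> \<exists>m l. (f ^^ m) a = (f ^^ l) b"
proof -
  let ?D = "functional_digraph V f"
  have max: "pre_digraph.max_subgraph ?D Digraph_Component.connected C"
    using C by (simp add: components_def)
  have sub: "subgraph C ?D" and conn: "Digraph_Component.connected C"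
    using max by (auto simp: pre_digraph.max_subgraph_def)
  have th: "tail C = fst" "head C = snd"
    using sub by (auto simp: subgraph_def compatible_def functional_digraph_def)
  interpret C: wf_digraph C using sub by (simp add: subgraph_def)
  show VC: "verts C \<subseteq> V" using sub by (auto simp: subgraph_def functional_digraph_def)
  show "verts C \<noteq> {}" using conn by (simp add: connected_conv)
  have sub_arcs: "arcs C \<subseteq> {(a, f a) | a. a \<in> V}"
    using sub by (auto simp: subgraph_def functional_digraph_def)
  have arc: "(a, f a) \<in> arcs C" if "a \<in> V" "a \<in> verts C \<or> f a \<in> verts C" for a
    using that max_connected_subgraph_arc[OF max, of "(a, f a)"]
    by (auto simp: functional_digraph_def)
  have ends: "a \<in> verts C \<and> f a \<in> verts C" if "(a, f a) \<in> arcs C" for a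
    using C.tail_in_verts[OF that] C.head_in_verts[OF that] by (simp add: th)
  show "f a \<in> verts C \<longleftrightarrow> a \<in> verts C" if "a \<in> V" for a
    using arc ends that by blast
  have "arcs C = {(a, f a) | a. a \<in> verts C}"
    using sub_arcs arc ends VC by blast
  then show eq: "C = functional_digraph (verts C) f"
    using th by (simp add: functional_digraph_def)
  show "\<exists>m l. (f ^^ m) a = (f ^^ l) b" if "a \<in> verts C" "b \<in> verts C" for a b
  proof -
    have "(b, a) \<in> rtrancl_on (verts C) ((arcs_ends C)\<^sup>s)"
      using conn that by (simp add: connected_conv)
    then show ?thesis
    proof (induction rule: rtrancl_on_induct)
      case base
      show ?case by blast
    next
      case (step x y)
      then obtain m l where ml: "(f ^^ m) x = (f ^^ l) b" by blast
      have "arcs_ends C = {(a, f a) | a. a \<in> verts C}"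
        by (subst eq) (rule arcs_ends_functional_digraph)
      with step.hyps have "y = f x \<or> x = f y" by (auto simp: symcl_def)
      then show ?case
      proof
        assume "y = f x"
        then have "(f ^^ m) y = f ((f ^^ m) x)" by (simp add: funpow_swap1)
        then have "(f ^^ m) y = (f ^^ Suc l) b" by (simp add: ml)
        then show ?thesis by blast
      next
        assume "x = f y"
        then have "(f ^^ Suc m) y = (f ^^ l) b" using ml by (simp add: funpow_swap1)
        then show ?thesis by blast
      qed
    qed
  qed
qed

text \<open>
  The number \<open>r\<close> is the least period of \<open>c\<close>, expressed through the distinctness of the first \<open>r\<close>
  iterates.
\<close>
definition periodic_orbit :: "('a \<Rightarrow> 'a) \<Rightarrow> 'a \<Rightarrow> nat \<Rightarrow> bool" where
  "periodic_orbit f c r \<longleftrightarrow> 0 < r \<and> (f ^^ r) c = c \<and> inj_on (\<lambda>i. (f ^^ i) c) {..<r}"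

lemma periodic_orbit_eq_iff:
  assumes "periodic_orbit f c r"
  shows "(f ^^ a) c = (f ^^ b) c \<longleftrightarrow> a mod r = b mod r"
proof -
  have "(f ^^ a) c = (f ^^ b) c \<longleftrightarrow> (f ^^ (a mod r)) c = (f ^^ (b mod r)) c"
    using assms by (simp add: periodic_orbit_def funpow_mod_eq)
  also have "\<dots> \<longleftrightarrow> a mod r = b mod r"
    using assms by (auto simp: periodic_orbit_def dest: inj_onD)
  finally show ?thesis .
qed

text \<open>
  By the pigeonhole principle two iterates of \<open>a\<close> agree, so one of them is periodic.
\<close>
lemma ex_periodic_orbit:
  assumes "finite V" "f \<in> V \<rightarrow> V" "a \<in> V"
  shows "\<exists>m r. periodic_orbit f ((f ^^ m) a) r"
proof -
  have "(f ^^ m) a \<in> V" for m using assms by (induction m) auto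
  then have "finite (range (\<lambda>m. (f ^^ m) a))"
    using assms(1) by (auto intro: finite_subset)
  then have "\<not> inj (\<lambda>m. (f ^^ m) a)"
    using finite_imageD infinite_UNIV_nat by blast
  then obtain i j where ij: "i < j" "(f ^^ i) a = (f ^^ j) a"
    by (metis (mono_tags, lifting) injI nat_neq_iff)
  define c where "c = (f ^^ i) a"
  define r where "r = (LEAST d. 0 < d \<and> (f ^^ d) c = c)"
  have "(f ^^ (j - i)) c = (f ^^ (j - i + i)) a" by (simp only: c_def funpow_add comp_apply)
  then have "0 < j - i \<and> (f ^^ (j - i)) c = c"
    using ij by (simp add: c_def)
  then have r: "0 < r \<and> (f ^^ r) c = c"
    unfolding r_def by (rule LeastI)
  have least: "r \<le> d" if "0 < d" "(f ^^ d) c = c" for d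
    unfolding r_def using that by (intro Least_le) simp
  \<comment> \<open>Going on from \<open>y\<close> up to the full period shows that \<open>r - y + x\<close> is a period below \<open>r\<close>.\<close>
  have ne: "(f ^^ x) c \<noteq> (f ^^ y) c" if "x < y" "y < r" for x y
  proof
    assume eq: "(f ^^ x) c = (f ^^ y) c"
    have "(f ^^ (r - y + x)) c = (f ^^ (r - y)) ((f ^^ y) c)"
      by (simp add: funpow_add eq)
    also have "\<dots> = (f ^^ (r - y + y)) c" by (simp only: funpow_add comp_apply)
    also have "\<dots> = c" using r that by simp
    finally show False using least[of "r - y + x"] that by simp
  qed
  have "inj_on (\<lambda>i. (f ^^ i) c) {..<r}"
    by (rule linorder_inj_onI) (auto simp: ne)
  then show ?thesis using r unfolding c_def periodic_orbit_def by blast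
qed

text \<open>
  Every vertex has only one outgoing arc, so a walk is determined by its start and its length.
\<close>
lemma awalk_functional_digraph:
  assumes u: "u \<in> W" and f: "f \<in> W \<rightarrow> W"
  shows "pre_digraph.awalk (functional_digraph W f) u p v \<longleftrightarrow>
    p = map (\<lambda>i. ((f ^^ i) u, (f ^^ Suc i) u)) [0..<length p] \<and> v = (f ^^ length p) u"
  using u
proof (induction p arbitrary: u)
  case Nil
  then show ?case
    by (auto simp: pre_digraph.awalk_def pre_digraph.cas.simps functional_digraph_def)
next
  case (Cons e p)
  let ?D = "functional_digraph W f"
  have fu: "f u \<in> W" using Cons.prems f by auto
  have "pre_digraph.awalk ?D u (e # p) v \<longleftrightarrow> e = (u, f u) \<and> pre_digraph.awalk ?D (f u) p v"
    using Cons.prems fu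
    by (auto simp: pre_digraph.awalk_def pre_digraph.cas.simps functional_digraph_def)
  also have "\<dots> \<longleftrightarrow> e = (u, f u) \<and>
      p = map (\<lambda>i. ((f ^^ i) (f u), (f ^^ Suc i) (f u))) [0..<length p] \<and> v = (f ^^ length p) (f u)"
    using Cons.IH[OF fu] by simp
  also have "map (\<lambda>i. ((f ^^ i) (f u), (f ^^ Suc i) (f u))) [0..<length p]
      = map (\<lambda>i. ((f ^^ i) u, (f ^^ Suc i) u)) (map Suc [0..<length p])"
    by (simp add: funpow_swap1)
  finally show ?case
    by (simp add: funpow_swap1 map_Suc_upt upt_conv_Cons del: upt_Suc)
qed

lemma cycle_functional_digraph:
  assumes f: "f \<in> W \<rightarrow> W"
  shows "pre_digraph.cycle (functional_digraph W f) p \<longleftrightarrow>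
    (\<exists>u\<in>W. p = map (\<lambda>i. ((f ^^ i) u, (f ^^ Suc i) u)) [0..<length p] \<and> p \<noteq> [] \<and>
      (f ^^ length p) u = u \<and> inj_on (\<lambda>i. (f ^^ Suc i) u) {..<length p})"
proof -
  let ?D = "functional_digraph W f"
  have tl_verts: "distinct (tl (pre_digraph.awalk_verts ?D u p))
      \<longleftrightarrow> inj_on (\<lambda>i. (f ^^ Suc i) u) {..<length p}"
    if u: "u \<in> W" and w: "pre_digraph.awalk ?D u p u" and "p \<noteq> []" for u
  proof -
    have "tl (pre_digraph.awalk_verts ?D u p) = map snd p"
      using w that pre_digraph.awalk_verts_conv'[of ?D u p u]
      by (simp add: pre_digraph.awalk_def functional_digraph_def)
    also have "\<dots> = map (\<lambda>i. (f ^^ Suc i) u) [0..<length p]"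
      using w awalk_functional_digraph[OF u f, of p u]
      by (metis (no_types, lifting) map_map map_eq_conv comp_apply snd_conv)
    finally show ?thesis by (simp add: distinct_map atLeast0LessThan)
  qed
  have "pre_digraph.cycle ?D p \<longleftrightarrow> (\<exists>u\<in>W. pre_digraph.awalk ?D u p u \<and>
      distinct (tl (pre_digraph.awalk_verts ?D u p)) \<and> p \<noteq> [])"
    by (auto simp: pre_digraph.cycle_def pre_digraph.awalk_def functional_digraph_def)
  then show ?thesis
    using tl_verts awalk_functional_digraph[OF _ f] by (smt (verit, best))
qed

text \<open>
  A cycle starting at \<open>u\<close> makes \<open>u\<close> periodic, and since orbits merge, \<open>u\<close> lies on the orbit of
  \<open>c\<close>. Hence the cycle length is a multiple of \<open>r\<close>; beyond \<open>r\<close> vertices would repeat.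
\<close>
lemma cycle_length_functional_digraph:
  assumes f: "f \<in> W \<rightarrow> W" and c: "c \<in> W" "periodic_orbit f c r"
    and conn: "\<And>a. a \<in> W \<Longrightarrow> \<exists>m l. (f ^^ m) a = (f ^^ l) c"
  shows "cycle_length (functional_digraph W f) = r"
  unfolding cycle_length_def
proof (rule the_equality)
  have r: "0 < r" "(f ^^ r) c = c" using c(2) by (simp_all add: periodic_orbit_def)
  have "inj_on (\<lambda>i. (f ^^ Suc i) c) {..<r}"
  proof (rule linorder_inj_onI)
    fix i j assume "i < j" "j \<in> {..<r}"
    then have "Suc i mod r \<noteq> Suc j mod r"
      by (cases "Suc j = r") auto
    then show "(f ^^ Suc i) c \<noteq> (f ^^ Suc j) c"
      by (simp only: periodic_orbit_eq_iff[OF c(2)] not_False_eq_True)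
  qed auto
  then show "\<exists>p. pre_digraph.cycle (functional_digraph W f) p \<and> length p = r"
    unfolding cycle_functional_digraph[OF f] using c r
    by (intro exI[of _ "map (\<lambda>i. ((f ^^ i) c, (f ^^ Suc i) c)) [0..<r]"]) (auto intro!: bexI[of _ c])
next
  fix l assume "\<exists>p. pre_digraph.cycle (functional_digraph W f) p \<and> length p = l"
  then obtain u where u: "u \<in> W" "0 < l" "(f ^^ l) u = u" "inj_on (\<lambda>i. (f ^^ Suc i) u) {..<l}"
    unfolding cycle_functional_digraph[OF f] by auto
  obtain m n where mn: "(f ^^ m) u = (f ^^ n) c" using conn u(1) by blast
  \<comment> \<open>Since \<open>l * m\<close> is a period of \<open>u\<close>, one gets back to \<open>u\<close> from the meeting point.\<close>
  define e where "e = (l * m - m) + n"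
  have "m \<le> l * m" using u(2) by simp
  have "u = (f ^^ (l * m)) u"
    using funpow_mod_eq[OF u(3), of "l * m"] by simp
  also have "\<dots> = (f ^^ (l * m - m + m)) u" using \<open>m \<le> l * m\<close> by simp
  also have "\<dots> = (f ^^ e) c" by (simp only: e_def funpow_add comp_apply mn)
  finally have ue: "u = (f ^^ e) c" .
  have "(f ^^ (l + e)) c = (f ^^ e) c"
    using u(3) ue by (simp add: funpow_add)
  then have "r dvd l"
    using periodic_orbit_eq_iff[OF c(2)] mod_eq_dvd_iff_nat[of e "l + e" r] by simp
  then have "r \<le> l" using u(2) by (simp add: dvd_imp_le)
  moreover have "\<not> r < l"
  proof
    assume "r < l"
    have "(f ^^ (Suc r + e)) c = (f ^^ (Suc 0 + e)) c"
      using mod_add_self2[of "Suc 0 + e" r] by (simp only: periodic_orbit_eq_iff[OF c(2)]) (simp add: add.commute)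
    then have "(f ^^ Suc r) u = (f ^^ Suc 0) u"
      unfolding ue by (simp only: funpow_add comp_apply)
    then have "r = 0" using u(2,4) \<open>r < l\<close> by (meson inj_onD lessThan_iff)
    then show False using c(2) by (simp add: periodic_orbit_def)
  qed
  ultimately show "l = r" by simp
qed


section \<open>Trees hung on a permutation\<close>

text \<open>
  The model of a component: over each point \<open>j\<close> of the domain of \<open>\<sigma>\<close> hangs a copy of a tree with
  root \<open>e\<close> and parent map \<open>f\<close>, and the roots are moved by \<open>\<sigma>\<close>. When \<open>f e = e\<close>,
  projection to the first coordinate carries the model map to \<open>f\<close>.
\<close>
definition hang_on :: "'a \<Rightarrow> ('a \<Rightarrow> 'a) \<Rightarrow> ('b \<Rightarrow> 'b) \<Rightarrow> 'a \<times> 'b \<Rightarrow> 'a \<times> 'b" where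
  "hang_on e f \<sigma> = (\<lambda>(x, j). if x = e then (e, \<sigma> j) else (f x, j))"

lemma fst_funpow_hang_on:
  assumes "f e = e"
  shows "fst ((hang_on e f \<sigma> ^^ m) z) = (f ^^ m) (fst z)"
  using assms by (induction m) (auto simp: hang_on_def split: prod.split)

lemma funpow_hang_on_root: "(hang_on e f \<sigma> ^^ m) (e, j) = (e, (\<sigma> ^^ m) j)"
  by (induction m) (auto simp: hang_on_def)

text \<open>
  The roots are exactly the periodic points of the model, hence are permuted among themselves, say
  by \<open>q\<close>. On its way to its own root a vertex meets no other root, so a copy of the tree is
  mapped into a single copy. The family \<open>g\<close> is indexed by the copy
  \<^emph>\<open>reached\<close>, because in the wreath product the permutation of the blocks acts first.
\<close>
lemma commuting_perm_hang_on_decomp: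
  assumes f: "f \<in> T \<rightarrow> T" "f e = e" "e \<in> T" and root: "\<And>x. x \<in> T \<Longrightarrow> \<exists>m. (f ^^ m) x = e"
    and \<sigma>: "\<sigma> permutes \<Delta>" "finite \<Delta>"
    and p: "p \<in> commuting_perms (T \<times> \<Delta>) (hang_on e f \<sigma>)"
  obtains q g where "q \<in> commuting_perms \<Delta> \<sigma>"
    and "\<And>j. j \<in> \<Delta> \<Longrightarrow> g j \<in> commuting_perms T f \<and> g j e = e"
    and "\<And>x j. x \<in> T \<Longrightarrow> j \<in> \<Delta> \<Longrightarrow> p (x, j) = (g (q j) x, q j)"
proof -
  let ?F = "hang_on e f \<sigma>" and ?V = "T \<times> \<Delta>"
  have \<sigma>\<Delta>: "\<sigma> j \<in> \<Delta>" if "j \<in> \<Delta>" for j using that permutes_in_image[OF \<sigma>(1)] by simp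
  have F: "?F \<in> ?V \<rightarrow> ?V" using f \<sigma>\<Delta> by (auto simp: hang_on_def)
  have perm: "p permutes ?V" and comm: "\<And>z. z \<in> ?V \<Longrightarrow> p (?F z) = ?F (p z)"
    using p by (auto simp: commuting_perms_def)
  have pV: "p z \<in> ?V" if "z \<in> ?V" for z using that permutes_in_image[OF perm] by simp
  have p_inj: "z = w" if "p z = p w" for z w using that permutes_inj[OF perm] by (auto dest: injD)
  define q where "q j = snd (p (e, j))" for j
  obtain N where N: "\<sigma> ^^ N = id" "0 < N"
    using permutation_is_nilpotent \<sigma> by (metis permutation_permutes)
  \<comment> \<open>Some multiple of the period \<open>N\<close> is at least the distance of \<open>x\<close> from \<open>e\<close>, where \<open>f\<close> stays.\<close>
  have periodic_root: "x = e" if x: "x \<in> T" and per: "(f ^^ N) x = x" for x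
  proof -
    obtain m where m: "(f ^^ m) x = e" using root x by blast
    have fe: "(f ^^ i) e = e" for i using f(2) by (induction i) auto
    have "m \<le> N * m" using N(2) by simp
    have "x = (f ^^ (N * m)) x" using funpow_mod_eq[OF per, of "N * m"] by simp
    also have "\<dots> = (f ^^ (N * m - m + m)) x" using \<open>m \<le> N * m\<close> by simp
    also have "\<dots> = e" by (simp only: funpow_add comp_apply m fe)
    finally show ?thesis .
  qed
  have p_root: "p (e, j) = (e, q j)" "q j \<in> \<Delta>" if j: "j \<in> \<Delta>" for j
  proof -
    have ej: "(e, j) \<in> ?V" using j f by simp
    have "(?F ^^ N) (p (e, j)) = p ((?F ^^ N) (e, j))"
      using commuting_perms_funpow[OF p F ej] by simp
    also have "\<dots> = p (e, j)" by (simp add: funpow_hang_on_root N)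
    finally have "(f ^^ N) (fst (p (e, j))) = fst (p (e, j))"
      using fst_funpow_hang_on[where f = f and e = e and \<sigma> = \<sigma>, OF f(2)] by metis
    then have "fst (p (e, j)) = e"
      using pV[OF ej] by (intro periodic_root) auto
    then show "p (e, j) = (e, q j)" by (simp add: q_def prod_eq_iff)
    then show "q j \<in> \<Delta>" using pV[OF ej] by simp
  qed
  have q_inj: "inj_on q \<Delta>"
  proof (rule inj_onI)
    fix i j assume "i \<in> \<Delta>" "j \<in> \<Delta>" "q i = q j"
    then have "p (e, i) = p (e, j)" by (simp add: p_root)
    then show "i = j" by (auto dest: p_inj)
  qed
  have q_surj: "q ` \<Delta> = \<Delta>"
    using q_inj p_root \<sigma>(2) by (intro endo_inj_surj) auto
  have q_perm: "q permutes \<Delta>"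
    using q_inj q_surj permutes_not_in[OF perm]
    by (intro bij_imp_permutes) (auto simp: bij_betw_def q_def)
  have "q (\<sigma> j) = \<sigma> (q j)" if j: "j \<in> \<Delta>" for j
    using comm[of "(e, j)"] p_root[OF j] p_root[OF \<sigma>\<Delta>[OF j]] j f by (simp add: hang_on_def)
  then have q_comm: "q \<in> commuting_perms \<Delta> \<sigma>" using q_perm by (simp add: commuting_perms_def)
  have non_root: "fst (p (x, j)) \<noteq> e" if "x \<in> T" "j \<in> \<Delta>" "x \<noteq> e" for x j
  proof
    assume root': "fst (p (x, j)) = e"
    have "snd (p (x, j)) \<in> q ` \<Delta>"
      using pV[of "(x, j)"] that q_surj by (simp add: mem_Times_iff)
    then obtain i where i: "i \<in> \<Delta>" "snd (p (x, j)) = q i" by blast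
    then have "p (x, j) = p (e, i)" using root' p_root by (simp add: prod_eq_iff)
    then show False using that by (auto dest: p_inj)
  qed
  \<comment> \<open>The copy containing a vertex does not change on the way to the root.\<close>
  have block: "snd (p (x, j)) = q j" if "(f ^^ m) x = e" "x \<in> T" "j \<in> \<Delta>" for m x j
    using that
  proof (induction m arbitrary: x)
    case 0
    then show ?case by (simp add: q_def)
  next
    case (Suc m)
    show ?case
    proof (cases "x = e")
      case True
      then show ?thesis by (simp add: q_def)
    next
      case False
      have "snd (p (f x, j)) = q j"
        using Suc f by (intro Suc.IH) (auto simp: funpow_swap1)
      moreover have "p (f x, j) = ?F (p (x, j))"
        using comm[of "(x, j)"] Suc.prems False by (simp add: hang_on_def)
      ultimately show ?thesis
        using non_root[OF Suc.prems(2,3) False] by (simp add: hang_on_def case_prod_beta)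
    qed
  qed
  have p_eq: "p (x, j) = (fst (p (x, j)), q j)" if "x \<in> T" "j \<in> \<Delta>" for x j
    using block root that by (metis prod.collapse)
  define g where "g i x = fst (p (x, inv_into UNIV q i))" for i x
  have g: "g i \<in> commuting_perms T f \<and> g i e = e" if i: "i \<in> \<Delta>" for i
  proof -
    define j where "j = inv_into UNIV q i"
    have j: "j \<in> \<Delta>" "q j = i"
      using i permutes_in_image[OF permutes_inv[OF q_perm]] permutes_inverses(1)[OF q_perm]
      by (simp_all add: j_def)
    have g_def': "g i x = fst (p (x, j))" for x by (simp add: g_def j_def)
    have pg: "p (x, j) = (g i x, i)" if "x \<in> T" for x
      using p_eq[OF that j(1)] j by (simp add: g_def')
    have gT: "g i x \<in> T" if "x \<in> T" for x
      using pV[of "(x, j)"] that j pg by auto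
    have "inj_on (g i) T"
      by (rule inj_onI) (metis pg p_inj prod.inject)
    moreover have "g i ` T = T"
    proof
      show "g i ` T \<subseteq> T" using gT by auto
      show "T \<subseteq> g i ` T"
      proof
        fix y assume y: "y \<in> T"
        have "(y, i) \<in> p ` ?V" using permutes_image[OF perm] y i by simp
        then obtain x l where xl: "x \<in> T" "l \<in> \<Delta>" "p (x, l) = (y, i)" by auto
        then have "q l = q j" using p_eq j by (metis prod.inject)
        then have "l = j" using q_inj xl j by (auto dest: inj_onD)
        then show "y \<in> g i ` T" using xl pg by auto
      qed
    qed
    ultimately have "bij_betw (g i) T T" by (simp add: bij_betw_def)
    moreover have "g i x = x" if "x \<notin> T" for x
      using that permutes_not_in[OF perm, of "(x, j)"] by (simp add: g_def')
    ultimately have "g i permutes T" by (rule bij_imp_permutes)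
    moreover have ge: "g i e = e" using p_root[OF j(1)] by (simp add: g_def')
    moreover have "g i (f x) = f (g i x)" if x: "x \<in> T" for x
    proof (cases "x = e")
      case True
      then show ?thesis using ge f by simp
    next
      case False
      have "(g i (f x), i) = p (?F (x, j))"
        using x False f by (simp add: hang_on_def pg Pi_iff)
      also have "\<dots> = ?F (g i x, i)" using comm[of "(x, j)"] x j pg by simp
      also have "\<dots> = (f (g i x), i)"
        using non_root[OF x j(1) False] by (simp add: hang_on_def g_def')
      finally show ?thesis by simp
    qed
    ultimately show ?thesis by (simp add: commuting_perms_def)
  qed
  have "p (x, j) = (g (q j) x, q j)" if "x \<in> T" "j \<in> \<Delta>" for x j
    using p_eq[OF that] permutes_inverses(2)[OF q_perm] by (simp add: g_def)
  with q_comm g show ?thesis by (rule that)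
qed

text \<open>
  The generators of the wreath product visibly commute with the model map. Conversely, the
  decomposition above writes a commuting permutation as an element of the base group composed
  with a permutation of the blocks. The top group has to be the centralizer of \<open>\<sigma>\<close> because this
  describes the possible permutations of the roots.
\<close>
lemma wreath_product_eq_commuting_perms:
  assumes f: "f \<in> T \<rightarrow> T" "f e = e" "e \<in> T" and root: "\<And>x. x \<in> T \<Longrightarrow> \<exists>m. (f ^^ m) x = e"
    and \<sigma>: "\<sigma> permutes \<Delta>" "finite \<Delta>"
    and P: "carrier P = {p \<in> commuting_perms T f. p e = e}"
    and Q: "carrier Q = commuting_perms \<Delta> \<sigma>"
  shows "wreath_product T P \<Delta> Q
    = (sym_group_on (T \<times> \<Delta>)) \<lparr> carrier := commuting_perms (T \<times> \<Delta>) (hang_on e f \<sigma>) \<rparr>"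
proof -
  let ?F = "hang_on e f \<sigma>" and ?V = "T \<times> \<Delta>"
  let ?S = "sym_group_on ?V" and ?A = "commuting_perms ?V ?F"
  let ?gen = "wreath_base P \<Delta> \<union> wreath_top T Q"
  interpret S: group ?S by (rule group_sym_group_on)
  have \<sigma>\<Delta>: "\<sigma> j \<in> \<Delta>" if "j \<in> \<Delta>" for j using that permutes_in_image[OF \<sigma>(1)] by simp
  have F: "?F \<in> ?V \<rightarrow> ?V" using f \<sigma>\<Delta> by (auto simp: hang_on_def)
  have base_S: "wreath_base P \<Delta> \<subseteq> carrier ?S"
    using P by (intro wreath_base_subset) (auto simp: commuting_perms_def)
  have top_S: "wreath_top T Q \<subseteq> carrier ?S"
    using Q by (intro wreath_top_subset) (auto simp: commuting_perms_def)
  have "wreath_base P \<Delta> \<subseteq> ?A"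
  proof
    fix h assume h: "h \<in> wreath_base P \<Delta>"
    then have perm: "h permutes ?V" using base_S by (auto simp: sym_group_on_def)
    obtain g where h_def: "h = (\<lambda>(x, j). (if j \<in> \<Delta> then g j x else x, j))"
      and g: "\<And>j. j \<in> \<Delta> \<Longrightarrow> g j \<in> commuting_perms T f \<and> g j e = e"
      using h P unfolding wreath_base_def by blast
    have ge: "g j x = e \<longleftrightarrow> x = e" if "j \<in> \<Delta>" for j x
      using g[OF that] permutes_inj[of "g j" T] by (auto simp: commuting_perms_def dest: injD)
    have "h (?F (x, j)) = ?F (h (x, j))" if "x \<in> T" "j \<in> \<Delta>" for x j
      using that g[of j] g[of "\<sigma> j"] \<sigma>\<Delta> ge by (auto simp: h_def hang_on_def commuting_perms_def)
    then show "h \<in> ?A" using perm by (auto simp: commuting_perms_def)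
  qed
  moreover have "wreath_top T Q \<subseteq> ?A"
  proof
    fix h assume h: "h \<in> wreath_top T Q"
    then have perm: "h permutes ?V" using top_S by (auto simp: sym_group_on_def)
    obtain q where h_def: "h = (\<lambda>(x, j). (x, if x \<in> T then q j else j))"
      and q: "q \<in> commuting_perms \<Delta> \<sigma>"
      using h Q unfolding wreath_top_def by blast
    have "h (?F (x, j)) = ?F (h (x, j))" if "x \<in> T" "j \<in> \<Delta>" for x j
      using that q f by (auto simp: h_def hang_on_def commuting_perms_def)
    then show "h \<in> ?A" using perm by (auto simp: commuting_perms_def)
  qed
  ultimately have "carrier (subgroup_generated ?S ?gen) \<subseteq> ?A"
    by (intro S.subgroup_generated_minimal subgroup_commuting_perms F) simp
  moreover have "?A \<subseteq> carrier (subgroup_generated ?S ?gen)"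
  proof
    fix p assume p: "p \<in> ?A"
    obtain q g where q: "q \<in> commuting_perms \<Delta> \<sigma>"
      and g: "\<And>j. j \<in> \<Delta> \<Longrightarrow> g j \<in> commuting_perms T f \<and> g j e = e"
      and p_eq: "\<And>x j. x \<in> T \<Longrightarrow> j \<in> \<Delta> \<Longrightarrow> p (x, j) = (g (q j) x, q j)"
      using commuting_perm_hang_on_decomp[OF f root \<sigma> p] by metis
    define b where "b = (\<lambda>(x, j). (if j \<in> \<Delta> then g j x else x, j))"
    define t where "t = (\<lambda>(x, j). (x, if x \<in> T then q j else j))"
    have b: "b \<in> wreath_base P \<Delta>" unfolding wreath_base_def b_def using g P by blast
    have t: "t \<in> wreath_top T Q" unfolding wreath_top_def t_def using q Q by blast
    have perms: "p permutes ?V" "b permutes ?V" "t permutes ?V"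
      using p b t base_S top_S by (auto simp: commuting_perms_def sym_group_on_def)
    have "q permutes \<Delta>" using q by (simp add: commuting_perms_def)
    have "p z = b (t z)" for z
    proof (cases "z \<in> ?V")
      case True
      then show ?thesis
        using p_eq permutes_in_image[OF \<open>q permutes \<Delta>\<close>] by (auto simp: b_def t_def)
    next
      case False
      then show ?thesis using perms by (simp add: permutes_not_in)
    qed
    then have "p = b \<otimes>\<^bsub>?S\<^esub> t" by (simp add: sym_group_on_def fun_eq_iff)
    moreover have "b \<in> generate ?S (carrier ?S \<inter> ?gen)" "t \<in> generate ?S (carrier ?S \<inter> ?gen)"
      using b t base_S top_S by (auto intro!: generate.incl)
    ultimately show "p \<in> carrier (subgroup_generated ?S ?gen)"
      by (simp add: carrier_subgroup_generated generate.eng)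
  qed
  ultimately have "carrier (subgroup_generated ?S ?gen) = ?A" by blast
  then show ?thesis
    unfolding wreath_product_def subgroup_generated_def by simp
qed

lemma funpow_cycle_of_upt:
  assumes "i < r"
  shows "(cycle_of_list [1..<Suc r] ^^ m) (Suc i) = Suc ((m + i) mod r)"
proof -
  let ?cs = "[1..<Suc r]"
  have "map (cycle_of_list ?cs ^^ m) ?cs ! i = rotate m ?cs ! i"
    by (subst cyclic_rotation) auto
  then show ?thesis using assms by (simp add: nth_rotate del: upt_Suc)
qed

text \<open>
  A full cycle generates its own centralizer: a permutation commuting with it is determined by
  its value at \<open>1\<close>, and the powers of the cycle realize every value.
\<close>
lemma generated_by_cycle_eq_commuting_perms:
  assumes r: "0 < r"
  shows "carrier (subgroup_generated (sym_group r) {cycle_of_list [1..<Suc r]})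
    = commuting_perms {1..r} (cycle_of_list [1..<Suc r])"
proof
  let ?\<sigma> = "cycle_of_list [1..<Suc r]"
  have S: "sym_group r = sym_group_on {1..r}" by (simp add: sym_group_def sym_group_on_def)
  interpret S: group "sym_group r" by (rule sym_group_is_group)
  have perm: "?\<sigma> permutes {1..r}"
    using cycle_permutes[of "[1..<Suc r]"] by (simp only: set_upt atLeastLessThanSuc_atLeastAtMost)
  have \<sigma>r: "?\<sigma> \<in> {1..r} \<rightarrow> {1..r}" using permutes_in_image[OF perm] by blast
  show "carrier (subgroup_generated (sym_group r) {?\<sigma>}) \<subseteq> commuting_perms {1..r} ?\<sigma>"
    using subgroup_commuting_perms[OF \<sigma>r] perm unfolding S[symmetric]
    by (intro S.subgroup_generated_minimal) (simp_all add: commuting_perms_def)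
  show "commuting_perms {1..r} ?\<sigma> \<subseteq> carrier (subgroup_generated (sym_group r) {?\<sigma>})"
  proof
    fix q assume q: "q \<in> commuting_perms {1..r} ?\<sigma>"
    then have q_perm: "q permutes {1..r}" by (simp add: commuting_perms_def)
    have pow: "?\<sigma> ^^ m \<in> generate (sym_group r) {?\<sigma>}" for m
    proof (induction m)
      case 0
      then show ?case using generate.one[of "sym_group r"] by (simp add: sym_group_one id_def)
    next
      case (Suc m)
      have "?\<sigma> \<otimes>\<^bsub>sym_group r\<^esub> (?\<sigma> ^^ m) \<in> generate (sym_group r) {?\<sigma>}"
        by (rule generate.eng[OF generate.incl Suc.IH]) simp
      then show ?case by (simp only: sym_group_mult funpow.simps)
    qed
    have "q 1 \<in> {1..r}" using permutes_in_image[OF q_perm] r by simp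
    then obtain i where i: "q 1 = Suc i" "i < r" by (cases "q 1") auto
    have \<sigma>_pow_perm: "(?\<sigma> ^^ i) permutes {1..r}" using perm by (rule permutes_funpow)
    have "q x = (?\<sigma> ^^ i) x" for x
    proof (cases "x \<in> {1..r}")
      case True
      then obtain j where j: "x = Suc j" "j < r" by (cases x) auto
      have "q x = q ((?\<sigma> ^^ j) 1)" using funpow_cycle_of_upt[of 0 r j] r j by simp
      also have "\<dots> = (?\<sigma> ^^ j) (q 1)" using r by (intro commuting_perms_funpow[OF q \<sigma>r]) simp
      also have "\<dots> = (?\<sigma> ^^ i) x"
        using funpow_cycle_of_upt[of i r j] funpow_cycle_of_upt[of j r i] i j by (simp add: add.commute)
      finally show ?thesis .
    next
      case False
      then show ?thesis using q_perm \<sigma>_pow_perm by (simp add: permutes_not_in)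
    qed
    then have "q = ?\<sigma> ^^ i" by blast
    then show "q \<in> carrier (subgroup_generated (sym_group r) {?\<sigma>})"
      using pow perm by (simp add: carrier_subgroup_generated sym_group_carrier)
  qed
qed


section \<open>Endomorphisms of commutative groups\<close>

locale comm_group_endo = comm_group H for H :: "('a, 'm) monoid_scheme" (structure) +
  fixes f :: "'a \<Rightarrow> 'a"
  assumes hom: "f \<in> hom H H"
begin

text \<open>
  The union of the kernels of the iterates of \<open>f\<close>, which for a power map is the vertex set of the
  identity tree. The height of an element is meaningful on this set only.
\<close>
definition nilpotent_part :: "'a set" where
  "nilpotent_part = {a \<in> carrier H. \<exists>m. (f ^^ m) a = \<one>}"

definition height :: "'a \<Rightarrow> nat" where
  "height a = (LEAST m. (f ^^ m) a = \<one>)"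

text \<open>
  The position \<open>t\<close> in the tree hanging at \<open>f\<^sup>j c\<close>, for \<open>c\<close> of period \<open>r\<close>. The second factor is
  meant to be the point on the cycle lying \<open>height t\<close> steps before \<open>f\<^sup>j c\<close>; going one step back is
  expressed as going \<open>r - 1\<close> steps forward.
\<close>
definition attach :: "nat \<Rightarrow> 'a \<Rightarrow> 'a \<times> nat \<Rightarrow> 'a" where
  "attach r c = (\<lambda>(t, j). t \<otimes> (f ^^ (j + (r - 1) * height t)) c)"

lemma f_one: "f \<one> = \<one>"
  using hom_one[OF hom] is_group by blast

lemma f_closed: "a \<in> carrier H \<Longrightarrow> f a \<in> carrier H"
  using hom by (auto simp: hom_def)

lemma funpow_closed: "a \<in> carrier H \<Longrightarrow> (f ^^ m) a \<in> carrier H"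
  by (induction m) (simp_all add: f_closed)

lemma funpow_mult: "a \<in> carrier H \<Longrightarrow> b \<in> carrier H \<Longrightarrow> (f ^^ m) (a \<otimes> b) = (f ^^ m) a \<otimes> (f ^^ m) b"
  by (induction m) (simp_all add: hom_mult[OF hom] funpow_closed)

lemma funpow_one: "(f ^^ m) \<one> = \<one>"
  by (induction m) (simp_all add: f_one)

lemma funpow_inv: "a \<in> carrier H \<Longrightarrow> (f ^^ m) (inv a) = inv ((f ^^ m) a)"
  using group_hom.hom_inv[of H H "f ^^ m"] is_group funpow_closed funpow_mult
  by (simp add: group_hom_def group_hom_axioms_def homI)

lemma one_nilpotent: "\<one> \<in> nilpotent_part"
  using funpow_one by (auto simp: nilpotent_part_def)

lemma f_nilpotent: "a \<in> nilpotent_part \<Longrightarrow> f a \<in> nilpotent_part"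
  unfolding nilpotent_part_def by (auto simp: f_closed) (metis f_one funpow_swap1)

lemma funpow_eq_one_mono:
  assumes "(f ^^ m) a = \<one>" "m \<le> l"
  shows "(f ^^ l) a = \<one>"
proof -
  have "(f ^^ (l - m + m)) a = \<one>" by (simp only: funpow_add comp_apply assms funpow_one)
  then show ?thesis using assms by simp
qed

lemma height_one: "height \<one> = 0"
  by (simp add: height_def)

lemma height_f:
  assumes "a \<in> nilpotent_part" "a \<noteq> \<one>"
  shows "height a = Suc (height (f a))"
proof -
  obtain m where "(f ^^ m) a = \<one>" using assms by (auto simp: nilpotent_part_def)
  then have "height a = Suc (LEAST m. (f ^^ Suc m) a = \<one>)"
    unfolding height_def using assms(2) by (intro Least_Suc) simp_all
  then show ?thesis by (simp add: height_def funpow_swap1)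
qed

text \<open>
  This is what makes the factorization of an element into a nilpotent and a periodic one unique.
\<close>
lemma nilpotent_periodic_eq_one:
  assumes "(f ^^ m) z = \<one>" "(f ^^ r) z = z" "0 < r"
  shows "z = \<one>"
proof -
  have "(f ^^ (r * m)) z = \<one>"
    using assms(1) by (rule funpow_eq_one_mono) (use assms(3) in simp)
  moreover have "(f ^^ (r * m)) z = z"
    using funpow_mod_eq[OF assms(2), of "r * m"] by simp
  ultimately show ?thesis by simp
qed

text \<open>
  The target is the component of \<open>c\<close>. Injectivity: if two products agree, the quotient of the
  nilpotent factors is both nilpotent and periodic, hence trivial. Surjectivity: if \<open>a\<close> meets the
  orbit of \<open>c\<close> after \<open>m\<close> steps, dividing \<open>a\<close> by the point of the cycle lying \<open>m\<close> steps before the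
  meeting point leaves an element killed by \<open>f\<^sup>m\<close>.
\<close>
lemma bij_betw_attach:
  assumes c: "c \<in> carrier H" and r: "periodic_orbit f c r"
  shows "bij_betw (attach r c) (nilpotent_part \<times> {1..r})
    {a \<in> carrier H. \<exists>m l. (f ^^ m) a = (f ^^ l) c}" (is "bij_betw _ ?A ?B")
proof -
  have r0: "0 < r" and per: "(f ^^ r) c = c" using r by (simp_all add: periodic_orbit_def)
  have per': "(f ^^ r) ((f ^^ l) c) = (f ^^ l) c" for l
    by (metis add.commute comp_apply funpow_add per)
  have cl: "(f ^^ l) c \<in> carrier H" for l using c by (rule funpow_closed)
  have "inj_on (attach r c) ?A"
  proof (rule inj_onI)
    fix z w assume zw: "z \<in> ?A" "w \<in> ?A" "attach r c z = attach r c w"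
    obtain t i s j where z: "z = (t, i)" and w: "w = (s, j)" by (cases z, cases w)
    have t: "t \<in> carrier H" and s: "s \<in> carrier H" using zw z w by (auto simp: nilpotent_part_def)
    define x where "x = (f ^^ (i + (r - 1) * height t)) c"
    define y where "y = (f ^^ (j + (r - 1) * height s)) c"
    have x: "x \<in> carrier H" "(f ^^ r) x = x" and y: "y \<in> carrier H" "(f ^^ r) y = y"
      by (simp_all add: x_def y_def cl per')
    have eq: "t \<otimes> x = s \<otimes> y" using zw(3) by (simp add: z w attach_def x_def y_def)
    define d where "d = inv s \<otimes> t"
    have "inv s \<otimes> (t \<otimes> x) \<otimes> inv x = inv s \<otimes> (s \<otimes> y) \<otimes> inv x" by (simp only: eq)
    then have d: "d = y \<otimes> inv x"
      using t s x y by (simp add: d_def m_assoc inv_solve_left')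
    obtain m where "(f ^^ m) t = \<one>" using zw z by (auto simp: nilpotent_part_def)
    moreover obtain n where "(f ^^ n) s = \<one>" using zw w by (auto simp: nilpotent_part_def)
    ultimately have "(f ^^ max m n) t = \<one>" "(f ^^ max m n) s = \<one>"
      by (auto intro: funpow_eq_one_mono)
    then have "(f ^^ max m n) d = \<one>" using t s by (simp add: d_def funpow_mult funpow_inv)
    moreover have "(f ^^ r) d = d" using x y by (simp add: d funpow_mult funpow_inv)
    ultimately have "d = \<one>" using r0 by (rule nilpotent_periodic_eq_one)
    then have ts: "t = s" using t s by (metis d_def inv_closed inv_equality inv_inv)
    then have "x = y" using eq t x y by simp
    then have "(i + (r - 1) * height t) mod r = (j + (r - 1) * height t) mod r"
      unfolding x_def y_def ts periodic_orbit_eq_iff[OF r] .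
    \<comment> \<open>Cancelling \<open>r - 1\<close> times the height modulo \<open>r\<close> amounts to adding the height.\<close>
    then have "(i + (r - 1) * height t + height t) mod r = (j + (r - 1) * height t + height t) mod r"
      by (rule mod_add_cong) (rule refl)
    moreover have "l + (r - 1) * height t + height t = l + r * height t" for l
      using r0 by (cases r) simp_all
    ultimately have "i mod r = j mod r" by (simp only: mod_mult_self2)
    then have "i = j"
      using zw z w r0 by (cases "i = r"; cases "j = r") auto
    then show "z = w" using ts z w by simp
  qed
  moreover have "attach r c ` ?A = ?B"
  proof
    show "attach r c ` ?A \<subseteq> ?B"
    proof
      fix a assume "a \<in> attach r c ` ?A"
      then obtain t j where t: "t \<in> nilpotent_part" and a: "a = attach r c (t, j)" by blast
      define l where "l = j + (r - 1) * height t"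
      have tc: "t \<in> carrier H" using t by (simp add: nilpotent_part_def)
      obtain m where "(f ^^ m) t = \<one>" using t by (auto simp: nilpotent_part_def)
      moreover have a_eq: "a = t \<otimes> (f ^^ l) c" by (simp add: a attach_def l_def)
      ultimately have "(f ^^ m) a = (f ^^ (m + l)) c"
        using tc c by (simp add: funpow_mult funpow_closed funpow_add)
      moreover have "a \<in> carrier H" using tc cl by (simp add: a_eq)
      ultimately show "a \<in> ?B" by blast
    qed
    show "?B \<subseteq> attach r c ` ?A"
    proof
      fix a assume "a \<in> ?B"
      then obtain m l where a: "a \<in> carrier H" and ml: "(f ^^ m) a = (f ^^ l) c" by blast
      define e where "e = l + (r - 1) * m"
      define t where "t = a \<otimes> inv ((f ^^ e) c)"
      have "m + e = l + r * m" using r0 by (cases r) (simp_all add: e_def)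
      then have "(f ^^ (m + e)) c = (f ^^ l) c"
        by (simp only: periodic_orbit_eq_iff[OF r] mod_mult_self2)
      then have "(f ^^ m) ((f ^^ e) c) = (f ^^ l) c" by (simp add: funpow_add)
      then have "(f ^^ m) t = \<one>"
        using a by (simp add: t_def funpow_mult funpow_inv cl ml)
      moreover have tc: "t \<in> carrier H" using a cl by (simp add: t_def)
      ultimately have t: "t \<in> nilpotent_part" by (auto simp: nilpotent_part_def)
      \<comment> \<open>The representative of \<open>e + height t\<close> modulo \<open>r\<close> in \<open>{1..r}\<close> rather than in \<open>{0..<r}\<close>.\<close>
      define j where "j = Suc ((e + height t + (r - 1)) mod r)"
      have "j \<in> {1..r}" using r0 by (simp add: j_def Suc_le_eq)
      have "(j + (r - 1) * height t) mod r = ((e + height t + (r - 1)) mod r + Suc ((r - 1) * height t)) mod r"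
        by (simp add: j_def)
      also have "\<dots> = (e + height t + (r - 1) + Suc ((r - 1) * height t)) mod r"
        by (rule mod_add_left_eq)
      also have "e + height t + (r - 1) + Suc ((r - 1) * height t) = e + r * Suc (height t)"
        using r0 by (cases r) simp_all
      finally have "(f ^^ (j + (r - 1) * height t)) c = (f ^^ e) c"
        by (simp only: periodic_orbit_eq_iff[OF r] mod_mult_self2)
      then have "attach r c (t, j) = a"
        using a cl by (simp add: attach_def t_def m_assoc)
      then show "a \<in> attach r c ` ?A" using t \<open>j \<in> {1..r}\<close> by force
    qed
  qed
  ultimately show ?thesis by (simp add: bij_betw_def)
qed

text \<open>
  Away from the root, a step of \<open>f\<close> advances both factors; as the height drops by one, the step
  back to be taken from \<open>f\<^sup>j c\<close> becomes shorter by one and \<open>j\<close> stays the same. At the root the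
  height is \<open>0\<close> already and \<open>j\<close> advances.
\<close>
lemma attach_hang_on:
  assumes c: "c \<in> carrier H" and r: "periodic_orbit f c r"
    and \<sigma>: "\<And>j. j \<in> {1..r} \<Longrightarrow> \<sigma> j mod r = Suc j mod r"
    and z: "z \<in> nilpotent_part \<times> {1..r}"
  shows "attach r c (hang_on \<one> f \<sigma> z) = f (attach r c z)"
proof -
  obtain t j where tj: "z = (t, j)" "t \<in> nilpotent_part" "j \<in> {1..r}" using z by blast
  have tc: "t \<in> carrier H" using tj by (simp add: nilpotent_part_def)
  have cl: "(f ^^ l) c \<in> carrier H" for l using c by (rule funpow_closed)
  have r0: "0 < r" using r by (simp add: periodic_orbit_def)
  show ?thesis
  proof (cases "t = \<one>")
    case True
    have "(f ^^ \<sigma> j) c = (f ^^ Suc j) c"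
      using \<sigma>[OF tj(3)] by (simp only: periodic_orbit_eq_iff[OF r])
    then show ?thesis
      using True cl[of j] cl[of "Suc j"] by (simp add: tj attach_def hang_on_def height_one f_closed)
  next
    case False
    define h where "h = height (f t)"
    have h: "height t = Suc h" using height_f[OF tj(2) False] by (simp add: h_def)
    have "Suc (j + (r - 1) * Suc h) = j + (r - 1) * h + r"
      using r0 by (cases r) simp_all
    then have "(f ^^ Suc (j + (r - 1) * Suc h)) c = (f ^^ (j + (r - 1) * h)) c"
      by (simp only: periodic_orbit_eq_iff[OF r] mod_add_self2)
    then show ?thesis
      using False tc cl hom_mult[OF hom tc cl[of "j + (r - 1) * Suc h"]]
      by (simp add: tj attach_def hang_on_def h flip: h_def)
  qed
qed

end


section \<open>Automorphisms of components of power digraphs\<close>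

text \<open>
  An automorphism of the tree fixes the root since this is the only vertex without an outgoing
  arc; given that, it commutes with \<open>f\<close> at the root too, although the loop there is deleted.
\<close>
lemma digraph_aut_identity_tree:
  assumes "comm_group_endo H f" and f: "f = (\<lambda>a. a [^]\<^bsub>H\<^esub> k)"
  defines "T \<equiv> comm_group_endo.nilpotent_part H f"
  shows "verts (identity_tree H k) = T"
    and "carrier (digraph_aut (identity_tree H k)) = {p \<in> commuting_perms T f. p \<one>\<^bsub>H\<^esub> = \<one>\<^bsub>H\<^esub>}"
proof -
  interpret comm_group_endo H f by fact
  let ?e = "\<one>\<^bsub>H\<^esub>"
  have pow: "(f ^^ m) a = a [^]\<^bsub>H\<^esub> (k ^ m)" if "a \<in> carrier H" for m a
    using that by (induction m) (simp_all add: f nat_pow_pow mult.commute)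
  have T: "{a \<in> carrier H. \<exists>m. a [^]\<^bsub>H\<^esub> (k ^ m) = ?e} = T"
    by (auto simp: T_def nilpotent_part_def pow)
  have TH: "T \<subseteq> carrier H" by (auto simp: T_def nilpotent_part_def)
  have fT: "f a \<in> T" if "a \<in> T" for a using that f_nilpotent by (simp add: T_def)
  have eT: "?e \<in> T" using one_nilpotent by (simp add: T_def)
  show verts: "verts (identity_tree H k) = T"
    unfolding identity_tree_def T by (simp add: pre_digraph.del_arc_def)
  have arcs: "arcs_ends (identity_tree H k) = {(a, f a) | a. a \<in> T \<and> a \<noteq> ?e}"
  proof -
    have "arcs (identity_tree H k) = {(a, f a) | a. a \<in> T \<and> a \<noteq> ?e}"
      using TH fT f_one unfolding identity_tree_def T
      by (auto simp: pre_digraph.del_arc_def power_digraph_functional functional_digraph_def simp flip: f)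
    moreover have "tail (identity_tree H k) = fst" "head (identity_tree H k) = snd"
      by (simp_all add: identity_tree_def pre_digraph.del_arc_def power_digraph_functional functional_digraph_def)
    ultimately show ?thesis by (simp add: arcs_ends_def arc_to_ends_def)
  qed
  have "(\<forall>u\<in>T. \<forall>v\<in>T. (p u, p v) \<in> arcs_ends (identity_tree H k) \<longleftrightarrow> (u, v) \<in> arcs_ends (identity_tree H k))
    \<longleftrightarrow> (\<forall>x\<in>T. p (f x) = f (p x)) \<and> p ?e = ?e" (is "?L \<longleftrightarrow> ?R") if p: "p permutes T" for p
  proof
    assume L: ?L
    have arc: "p u \<noteq> ?e \<and> p (f u) = f (p u)" if "u \<in> T" "u \<noteq> ?e" for u
    proof -
      have "(p u, p (f u)) \<in> arcs_ends (identity_tree H k)"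
        using L that fT[OF that(1)] by (auto simp: arcs)
      then show ?thesis by (auto simp: arcs)
    qed
    obtain u where "u \<in> T" "p u = ?e" using permutes_image[OF p] eT by (metis imageE)
    then have "p ?e = ?e" using arc by metis
    then show ?R using arc f_one by metis
  next
    assume R: ?R
    have pT: "p x \<in> T" if "x \<in> T" for x using that permutes_in_image[OF p] by simp
    have p_inj: "v = w" if "p v = p w" for v w using that permutes_inj[OF p] by (auto dest: injD)
    show ?L
      unfolding arcs using R pT p_inj by (smt (verit, best) Pair_inject mem_Collect_eq)
  qed
  then show "carrier (digraph_aut (identity_tree H k)) = {p \<in> commuting_perms T f. p ?e = ?e}"
    unfolding digraph_aut_def verts by (auto simp: commuting_perms_def)
qed

text \<open>
  Finiteness provides a periodic point \<open>c\<close> in the component. Conjugation with \<open>attach\<close> then turns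
  the automorphisms of the model, which form the wreath product, into those of the component.
\<close>
lemma aut_component_power_digraph:
  fixes H :: "('a, 'm) monoid_scheme"
  assumes H: "comm_group H" "finite (carrier H)" and C: "C \<in> components (power_digraph H k)"
  defines "r \<equiv> cycle_length C"
  shows "digraph_aut C \<cong>
    wreath_product (verts (identity_tree H k)) (digraph_aut (identity_tree H k))
      {1..r} (subgroup_generated (sym_group r) {cycle_of_list [1..<Suc r]})"
proof -
  define f where "f = (\<lambda>a. a [^]\<^bsub>H\<^esub> k)"
  interpret H: comm_group H by fact
  interpret comm_group_endo H f
    by unfold_locales (auto simp: f_def hom_def H.nat_pow_distrib)
  let ?T = nilpotent_part and ?\<sigma> = "cycle_of_list [1..<Suc r]"
  let ?F = "hang_on \<one>\<^bsub>H\<^esub> f ?\<sigma>"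
  have C': "C \<in> components (functional_digraph (carrier H) f)"
    using C by (simp add: power_digraph_functional f_def)
  note comp = component_functional_digraph[OF C']
  obtain a where a: "a \<in> verts C" using comp(2) by blast
  have "f \<in> carrier H \<rightarrow> carrier H" using f_closed by blast
  then obtain m l where orb: "periodic_orbit f ((f ^^ m) a) l"
    using ex_periodic_orbit[OF H(2), of f a] a comp(3) by blast
  define c where "c = (f ^^ m) a"
  have fC: "f \<in> verts C \<rightarrow> verts C" using comp(3,4) by blast
  have powC: "(f ^^ i) x \<in> verts C \<longleftrightarrow> x \<in> verts C" if "x \<in> carrier H" for i x
    using that by (induction i) (auto simp: comp(4) funpow_closed)
  have c: "c \<in> verts C" "c \<in> carrier H" using a powC comp(3) by (auto simp: c_def)
  have "r = l"
    unfolding r_def using cycle_length_functional_digraph[OF fC c(1)] orb comp(1,5) c by (metis c_def)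
  then have orb: "periodic_orbit f c r" using orb by (simp add: c_def)
  then have r0: "0 < r" by (simp add: periodic_orbit_def)
  have verts: "verts C = {a \<in> carrier H. \<exists>m l. (f ^^ m) a = (f ^^ l) c}"
  proof (intro subset_antisym subsetI)
    fix x assume "x \<in> verts C"
    then show "x \<in> {a \<in> carrier H. \<exists>m l. (f ^^ m) a = (f ^^ l) c}"
      using comp(3) comp(5)[OF _ c(1)] by blast
  next
    fix x assume "x \<in> {a \<in> carrier H. \<exists>m l. (f ^^ m) a = (f ^^ l) c}"
    then obtain m l where x: "x \<in> carrier H" and ml: "(f ^^ m) x = (f ^^ l) c" by blast
    have "(f ^^ m) x \<in> verts C" unfolding ml powC[OF c(2)] by (rule c(1))
    then show "x \<in> verts C" by (simp only: powC[OF x])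
  qed
  have \<sigma>: "?\<sigma> permutes {1..r}"
    using cycle_permutes[of "[1..<Suc r]"] by (simp only: set_upt atLeastLessThanSuc_atLeastAtMost)
  have \<sigma>_mod: "?\<sigma> j mod r = Suc j mod r" if "j \<in> {1..r}" for j
  proof -
    obtain i where "j = Suc i" "i < r" using \<open>j \<in> {1..r}\<close> by (cases j) auto
    then show ?thesis using funpow_cycle_of_upt[of i r 1] by (simp add: mod_Suc_eq del: upt_Suc)
  qed
  have fT: "f \<in> ?T \<rightarrow> ?T" using f_nilpotent by blast
  have F: "?F \<in> ?T \<times> {1..r} \<rightarrow> ?T \<times> {1..r}"
    using fT one_nilpotent permutes_in_image[OF \<sigma>] by (auto simp: hang_on_def)
  note tree = digraph_aut_identity_tree[OF comm_group_endo_axioms f_def]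
  have "wreath_product ?T (digraph_aut (identity_tree H k)) {1..r}
      (subgroup_generated (sym_group r) {?\<sigma>})
    = (sym_group_on (?T \<times> {1..r})) \<lparr> carrier := commuting_perms (?T \<times> {1..r}) ?F \<rparr>"
    using fT f_one one_nilpotent tree(2) generated_by_cycle_eq_commuting_perms[OF r0] \<sigma>
    by (intro wreath_product_eq_commuting_perms) (auto simp: nilpotent_part_def)
  also have "\<dots> \<cong> (sym_group_on (verts C)) \<lparr> carrier := commuting_perms (verts C) f \<rparr>"
    using bij_betw_attach[OF c(2) orb] F attach_hang_on[OF c(2) orb \<sigma>_mod]
    unfolding verts[symmetric] by (rule commuting_perms_iso)
  also have "\<dots> = digraph_aut C"
    using comp(1) digraph_aut_functional_digraph[OF fC] by metis
  finally show ?thesis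
    unfolding tree(1) by (rule group.iso_sym[OF group_wreath_product])
qed

theorem proposition5p2:
  fixes H :: "('a, 'm) monoid_scheme"
    and n k s :: nat
    and G :: "nat \<Rightarrow> ('a, 'a \<times> 'a) pre_digraph"
    and r :: "nat \<Rightarrow> nat"
  assumes "group H" and "cyclic_group H" and "order H = n"
    and "n > 1" and "1 \<le> k" and "k \<le> n"
    and "\<forall>i\<in>{1..s}. G i \<in> components (power_digraph H k)"
    and "\<forall>C\<in>components (power_digraph H k). \<exists>!i. i \<in> {1..s} \<and> digraph_iso (G i) C"
    and "\<forall>i\<in>{1..s}. r i = cycle_length (G i)"
  shows "\<forall>i\<in>{1..s}.
    digraph_aut (G i) \<cong>
      wreath_product
        (verts (identity_tree H k)) (digraph_aut (identity_tree H k))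
        {1..r i} (subgroup_generated (sym_group (r i)) {cycle_of_list [1..<Suc (r i)]})"
proof
  fix i assume i: "i \<in> {1..s}"
  have "comm_group H" using assms(1,2) by (rule group.cyclic_imp_abelian_group)
  moreover have "finite (carrier H)"
    using assms(3,4) by (metis card.infinite not_one_less_zero order_def)
  ultimately show "digraph_aut (G i) \<cong>
      wreath_product
        (verts (identity_tree H k)) (digraph_aut (identity_tree H k))
        {1..r i} (subgroup_generated (sym_group (r i)) {cycle_of_list [1..<Suc (r i)]})"
    using aut_component_power_digraph[of H "G i" k] assms(7,9) i by simp
qed

end
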